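(* Consider the single-reclaimer problem with given stockpile positions and no precedence constraints. An optimal (minimum-makespan) schedule can be computed in $O(n)$ time. Specifically, the following schedule is optimal: $R_0$ starts at $0$ and moves right, reclaiming stockpiles $1,2,\dots,n_1$ on pad $P_1$ each from left to right (traveling at speed $s$ between consecutive stockpiles); it then travels at speed $s$ to $r_n$ and reclaims stockpiles $n,n-1,\dots,n_1+1$ on pad $P_2$ each from right to left (traveling at speed $s$ between consecutive stockpiles); finally it travels at speed $s$ back to $0$.
   Context: Reclaimer scheduling model. Two pads $P_1,P_2$ are each modeled as the segment $[0,L]$, $L$ a positive integer. Stockpiles $1,\dots,n_1$ lie on $P_1$ and $n_1+1,\dots,n$ on $P_2$; stockpile $j$ occupies $[l_j,r_j]\subseteq[0,L]$ with integers $l_j<r_j$, and on each pad the stockpiles are non-overlapping and indexed from left to right ($r_j\le l_{j+1}$ for $j\in\{1,\dots,n_1-1\}$ and for $j\in\{n_1+1,\dots,n-1\}$). Reclaimers move along a rail represented by $[0,L]$. The reclaim speed is $1$ and the travel speed is $s\ge 1$. A schedule of reclaimer $R_k$ with makespan $C_k$ is a continuous piecewise linear function $H_k:[0,C_k]\to[0,L]$ (position over time) with $H_k(0)=H_k(C_k)=kL$, each linear piece having slope $0$ (idle), $\pm s$ (traveling without reclaiming) or $\pm 1$ (reclaiming a stockpile on one of the two pads; switching pads takes no time). A stockpile $j$ is reclaimed by traversing its whole interval $[l_j,r_j]$ once at speed $1$, in either direction, by a single reclaimer; this takes time $p_j=r_j-l_j$. In the single-reclaimer problem only $R_0$ works (starting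 and ending at $0$), $R_1$ stays at $L$, $R_0$ must reclaim every stockpile in any order, and the objective is to minimize the makespan $C_0$. *)

theory Defs
  imports Complex_Main "HOL-Library.Landau_Symbols"
begin

section \<open>Instances\<close>

text \<open>
  Stockpiles are numbered from 1 as in the mathematical text: 1, ..., \<open>pad1_count\<close> lie on the
  first pad and \<open>pad1_count + 1\<close>, ..., \<open>pile_count\<close> on the second.  Either pad may be empty.
  The values of \<open>left_end\<close> and \<open>right_end\<close> at other indices are irrelevant.
\<close>

record reclaim_instance =
  rail_len :: int
  travel_speed :: real
  pad1_count :: nat
  pile_count :: nat
  left_end :: "nat \<Rightarrow> int"
  right_end :: "nat \<Rightarrow> int"

definition valid_instance :: "reclaim_instance \<Rightarrow> bool" where
  "valid_instance I \<longleftrightarrow>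
     rail_len I > 0 \<and> travel_speed I \<ge> 1 \<and> pad1_count I \<le> pile_count I \<and>
     (\<forall>j\<in>{1..pile_count I}.
        0 \<le> left_end I j \<and> left_end I j < right_end I j \<and> right_end I j \<le> rail_len I) \<and>
     (\<forall>j\<in>{1..<pad1_count I}. right_end I j \<le> left_end I (j + 1)) \<and>
     (\<forall>j\<in>{pad1_count I + 1..<pile_count I}. right_end I j \<le> left_end I (j + 1))"

section \<open>Schedules\<close>

datatype activity = Idle | Travel | Reclaim nat

text \<open>
  \<open>position\<close> is the function \<open>H\<close>, of which only the restriction to \<open>[0, C]\<close> matters.
  Since slopes alone do not say which stockpile (on which pad) is being reclaimed, a
  schedule also records its breakpoints and the activity on each piece: activity \<open>i\<close> takes
  place between breakpoints \<open>i\<close> and \<open>i + 1\<close>.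
\<close>

record schedule =
  makespan :: real
  position :: "real \<Rightarrow> real"
  breakpoints :: "real list"
  activities :: "activity list"

definition linear_piece :: "(real \<Rightarrow> real) \<Rightarrow> real \<Rightarrow> real \<Rightarrow> real \<Rightarrow> bool" where
  "linear_piece H a b v \<longleftrightarrow> a \<le> b \<and> (\<forall>t\<in>{a..b}. H t = H a + v * (t - a))"

text \<open>
  Pieces may have length zero, which is vacuous for idling and traveling and impossible for
  reclaiming, because a reclaiming piece is the complete, uninterrupted traversal of a stockpile.
\<close>

fun performs ::
  "reclaim_instance \<Rightarrow> (real \<Rightarrow> real) \<Rightarrow> real \<Rightarrow> real \<Rightarrow> activity \<Rightarrow> bool" where
  "performs I H a b Idle \<longleftrightarrow> linear_piece H a b 0"
| "performs I H a b Travel \<longleftrightarrow>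
     linear_piece H a b (travel_speed I) \<or> linear_piece H a b (- travel_speed I)"
| "performs I H a b (Reclaim j) \<longleftrightarrow>
     j \<in> {1..pile_count I} \<and> b - a = of_int (right_end I j - left_end I j) \<and>
     (H a = of_int (left_end I j) \<and> linear_piece H a b 1 \<or>
      H a = of_int (right_end I j) \<and> linear_piece H a b (- 1))"

text \<open>Schedules of the reclaimer whose initial and final position is \<open>k L\<close>.\<close>

definition reclaimer_schedule :: "reclaim_instance \<Rightarrow> nat \<Rightarrow> schedule \<Rightarrow> bool" where
  "reclaimer_schedule I k S \<longleftrightarrow>
     (let C = makespan S; H = position S; ts = breakpoints S; as = activities S;
          L = real_of_int (rail_len I)
      in 0 \<le> C \<and> H 0 = real k * L \<and> H C = real k * L \<and>
         continuous_on {0..C} H \<and> H ` {0..C} \<subseteq> {0..L} \<and>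
         length ts = length as + 1 \<and> ts ! 0 = 0 \<and> ts ! length as = C \<and>
         (\<forall>i<length as. performs I H (ts ! i) (ts ! (i + 1)) (as ! i)))"

text \<open>
  In the single-reclaimer problem the second reclaimer stays at \<open>L\<close>.  It imposes no further
  constraint on the first one, whose position never exceeds \<open>L\<close>.
\<close>

definition feasible :: "reclaim_instance \<Rightarrow> schedule \<Rightarrow> bool" where
  "feasible I S \<longleftrightarrow>
     reclaimer_schedule I 0 S \<and>
     (\<forall>j\<in>{1..pile_count I}. \<exists>!i. i < length (activities S) \<and> activities S ! i = Reclaim j)"

definition optimal :: "reclaim_instance \<Rightarrow> schedule \<Rightarrow> bool" where
  "optimal I S \<longleftrightarrow> feasible I S \<and> (\<forall>S'. feasible I S' \<longrightarrow> makespan S \<le> makespan S')"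

section \<open>The sweep schedule\<close>

text \<open>A leg is an activity together with the position at which it ends.\<close>

type_synonym leg = "activity \<times> real"

definition sweep_legs :: "reclaim_instance \<Rightarrow> leg list" where
  "sweep_legs I =
     (let l = (\<lambda>j. real_of_int (left_end I j)); r = (\<lambda>j. real_of_int (right_end I j)) in
       concat (map (\<lambda>j. [(Travel, l j), (Reclaim j, r j)]) [1..<pad1_count I + 1]) @
       concat (map (\<lambda>j. [(Travel, r j), (Reclaim j, l j)])
                (rev [pad1_count I + 1..<pile_count I + 1])) @
       [(Travel, 0)])"

fun activity_speed :: "reclaim_instance \<Rightarrow> activity \<Rightarrow> real" where
  "activity_speed I Idle = 0"
| "activity_speed I Travel = travel_speed I"
| "activity_speed I (Reclaim j) = 1"

text \<open>In the next two functions \<open>x\<close> is the position at which the first leg starts.\<close>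

fun leg_breakpoints :: "reclaim_instance \<Rightarrow> real \<Rightarrow> real \<Rightarrow> leg list \<Rightarrow> real list" where
  "leg_breakpoints I t x [] = [t]"
| "leg_breakpoints I t x ((a, y) # legs) =
     t # leg_breakpoints I (t + \<bar>y - x\<bar> / activity_speed I a) y legs"

fun leg_position :: "reclaim_instance \<Rightarrow> real \<Rightarrow> leg list \<Rightarrow> real \<Rightarrow> real" where
  "leg_position I x [] t = x"
| "leg_position I x ((a, y) # legs) t =
     (let d = \<bar>y - x\<bar> / activity_speed I a in
       if t \<le> d then x + sgn (y - x) * activity_speed I a * t
       else leg_position I y legs (t - d))"

definition sweep :: "reclaim_instance \<Rightarrow> schedule" where
  "sweep I =
     \<lparr>makespan = last (leg_breakpoints I 0 0 (sweep_legs I)),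
      position = leg_position I 0 (sweep_legs I),
      breakpoints = leg_breakpoints I 0 0 (sweep_legs I),
      activities = map fst (sweep_legs I)\<rparr>"

section \<open>Unit-cost computation\<close>

text \<open>
  Running times refer to programs of a unit-cost real random-access machine, given as a while
  language over named one-dimensional arrays of natural numbers and of reals; a scalar is
  cell 0 of an array.  There is no conversion from reals to natural numbers, and natural
  numbers cannot be multiplied at unit cost.  Real literals are integers.  The expressions
  occurring in a program have bounded size, so charging one step per executed assignment or
  evaluated test counts elementary operations up to a constant factor.
\<close>

datatype nexp = NConst nat | NCell string nexp | NPlus nexp nexp | NMinus nexp nexp

datatype rexp = RConst int | RCell string nexp
  | RPlus rexp rexp | RMinus rexp rexp | RTimes rexp rexp | RDiv rexp rexp

datatype bexp = NLess nexp nexp | RLess rexp rexp | BNot bexp | BAnd bexp bexp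

datatype com = Skip | NAssign string nexp nexp | RAssign string nexp rexp
  | Seq com com | Cond bexp com com | While bexp com

record store =
  ncells :: "string \<Rightarrow> nat \<Rightarrow> nat"
  rcells :: "string \<Rightarrow> nat \<Rightarrow> real"

fun nval :: "nexp \<Rightarrow> store \<Rightarrow> nat" where
  "nval (NConst c) \<sigma> = c"
| "nval (NCell x e) \<sigma> = ncells \<sigma> x (nval e \<sigma>)"
| "nval (NPlus e f) \<sigma> = nval e \<sigma> + nval f \<sigma>"
| "nval (NMinus e f) \<sigma> = nval e \<sigma> - nval f \<sigma>"

fun rval :: "rexp \<Rightarrow> store \<Rightarrow> real" where
  "rval (RConst c) \<sigma> = of_int c"
| "rval (RCell x e) \<sigma> = rcells \<sigma> x (nval e \<sigma>)"
| "rval (RPlus e f) \<sigma> = rval e \<sigma> + rval f \<sigma>"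
| "rval (RMinus e f) \<sigma> = rval e \<sigma> - rval f \<sigma>"
| "rval (RTimes e f) \<sigma> = rval e \<sigma> * rval f \<sigma>"
| "rval (RDiv e f) \<sigma> = rval e \<sigma> / rval f \<sigma>"

fun bval :: "bexp \<Rightarrow> store \<Rightarrow> bool" where
  "bval (NLess e f) \<sigma> \<longleftrightarrow> nval e \<sigma> < nval f \<sigma>"
| "bval (RLess e f) \<sigma> \<longleftrightarrow> rval e \<sigma> < rval f \<sigma>"
| "bval (BNot b) \<sigma> \<longleftrightarrow> \<not> bval b \<sigma>"
| "bval (BAnd b c) \<sigma> \<longleftrightarrow> bval b \<sigma> \<and> bval c \<sigma>"

definition set_cell :: "(string \<Rightarrow> nat \<Rightarrow> 'a) \<Rightarrow> string \<Rightarrow> nat \<Rightarrow> 'a \<Rightarrow> string \<Rightarrow> nat \<Rightarrow> 'a" where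
  "set_cell m x i v = m(x := (m x)(i := v))"

text \<open>\<open>runs p \<sigma> c \<tau>\<close>: started in \<open>\<sigma>\<close>, program \<open>p\<close> terminates in \<open>\<tau>\<close> after \<open>c\<close> steps.\<close>

inductive runs :: "com \<Rightarrow> store \<Rightarrow> nat \<Rightarrow> store \<Rightarrow> bool" where
  runs_Skip: "runs Skip \<sigma> 1 \<sigma>"
| runs_NAssign: "runs (NAssign x i e) \<sigma> 1
    (\<sigma>\<lparr>ncells := set_cell (ncells \<sigma>) x (nval i \<sigma>) (nval e \<sigma>)\<rparr>)"
| runs_RAssign: "runs (RAssign x i e) \<sigma> 1
    (\<sigma>\<lparr>rcells := set_cell (rcells \<sigma>) x (nval i \<sigma>) (rval e \<sigma>)\<rparr>)"
| runs_Seq: "runs p \<sigma> c \<sigma>' \<Longrightarrow> runs q \<sigma>' d \<tau> \<Longrightarrow> runs (Seq p q) \<sigma> (c + d) \<tau>"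
| runs_CondTrue: "bval b \<sigma> \<Longrightarrow> runs p \<sigma> c \<tau> \<Longrightarrow> runs (Cond b p q) \<sigma> (c + 1) \<tau>"
| runs_CondFalse: "\<not> bval b \<sigma> \<Longrightarrow> runs q \<sigma> c \<tau> \<Longrightarrow> runs (Cond b p q) \<sigma> (c + 1) \<tau>"
| runs_WhileFalse: "\<not> bval b \<sigma> \<Longrightarrow> runs (While b p) \<sigma> 1 \<sigma>"
| runs_WhileTrue: "bval b \<sigma> \<Longrightarrow> runs p \<sigma> c \<sigma>' \<Longrightarrow> runs (While b p) \<sigma>' d \<tau> \<Longrightarrow>
    runs (While b p) \<sigma> (c + d + 1) \<tau>"

text \<open>All cells that do not hold input data are initially 0.\<close>

definition input_store :: "reclaim_instance \<Rightarrow> store" where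
  "input_store I =
     \<lparr>ncells = (\<lambda>x i.
        if x = ''n1'' \<and> i = 0 then pad1_count I
        else if x = ''n'' \<and> i = 0 then pile_count I
        else 0),
      rcells = (\<lambda>x i.
        if x = ''L'' \<and> i = 0 then of_int (rail_len I)
        else if x = ''s'' \<and> i = 0 then travel_speed I
        else if x = ''l'' \<and> i \<in> {1..pile_count I} then of_int (left_end I i)
        else if x = ''r'' \<and> i \<in> {1..pile_count I} then of_int (right_end I i)
        else 0)\<rparr>"

fun activity_code :: "activity \<Rightarrow> nat" where
  "activity_code Idle = 0"
| "activity_code Travel = 1"
| "activity_code (Reclaim j) = j + 2"

text \<open>
  A schedule is output as the number \<open>m\<close> of its pieces, their activities, and the times and
  positions of the \<open>m + 1\<close> breakpoints.  For a piecewise linear schedule this determines the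
  makespan and the position function on \<open>[0, C]\<close>.
\<close>

definition outputs :: "store \<Rightarrow> schedule \<Rightarrow> bool" where
  "outputs \<sigma> S \<longleftrightarrow>
     ncells \<sigma> ''m'' 0 = length (activities S) \<and>
     (\<forall>i<length (activities S). ncells \<sigma> ''act'' i = activity_code (activities S ! i)) \<and>
     (\<forall>i\<le>length (activities S).
        rcells \<sigma> ''t'' i = breakpoints S ! i \<and> rcells \<sigma> ''x'' i = position S (breakpoints S ! i))"

end

(*
  In every feasible schedule a piece covering distance d lasts d when reclaiming and at least
  d / s otherwise.  As each stockpile is reclaimed exactly once, the makespan is at least
  D / s + (1 - 1 / s) P, where P is the total length of the stockpiles and D the total distance
  covered.  The rightmost stockpile end M is visited and the walk is closed at 0, so D is at
  least 2 M.  The sweep never idles and covers exactly the distance 2 M.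
*)
theory Submission
  imports Defs
begin

section \<open>Lower bound\<close>

text \<open>The weights 1 / s and 1 - 1 / s come from writing the duration d of a reclaiming piece
  as d / s + (1 - 1 / s) d. The reclaimed length is the same in all feasible schedules, so only
  distance and idling can make a difference. For legs the same accounting is an equality, and
  optimality becomes a statement about distance: if A and B are the last stockpile ends on the two
  pads, sorted stockpiles rule out turning back while a pad is worked, and the sweep covers A + |B -
  A| + B = 2 max A B. The bound needs only the finite sequence of breakpoints, but feasibility of
  the sweep concerns a function of real time. Legs bridge the two: times and positions are recursive
  in the list of legs, and the proofs shift time at each leg. The program builds the same list at
  its other end, so its correctness is an invariant about prefixes.\<close>

abbreviation pile_len :: "reclaim_instance \<Rightarrow> nat \<Rightarrow> real" where
  "pile_len I j \<equiv> real_of_int (right_end I j - left_end I j)"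

fun reclaim_len :: "reclaim_instance \<Rightarrow> activity \<Rightarrow> real" where
  "reclaim_len I (Reclaim j) = pile_len I j"
| "reclaim_len I _ = 0"

lemma linear_pieceD:
  assumes "linear_piece H a b v"
  shows "a \<le> b" "H b = H a + v * (b - a)"
  using assms unfolding linear_piece_def by (blast, meson atLeastAtMost_iff order_refl)

text \<open>Traveling and reclaiming both attain equality; the only slack is the time spent
  idling.\<close>

lemma performs_duration:
  assumes "performs I H a b act" "travel_speed I \<ge> 1"
  shows "b - a \<ge> \<bar>H b - H a\<bar> / travel_speed I + (1 - 1 / travel_speed I) * reclaim_len I act"
proof (cases act)
  case Idle
  then show ?thesis using assms linear_pieceD[of H a b 0] by simp
next
  case Travel
  with assms have "H b = H a + travel_speed I * (b - a) \<or> H b = H a - travel_speed I * (b - a)"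
    and "a \<le> b"
    using linear_pieceD[of H a b "travel_speed I"] linear_pieceD[of H a b "- travel_speed I"]
    by auto
  then have "\<bar>H b - H a\<bar> = travel_speed I * (b - a)"
    using assms(2) by (auto simp: abs_mult)
  then show ?thesis using Travel assms(2) by simp
next
  case (Reclaim j)
  with assms have "H b = H a + (b - a) \<or> H b = H a - (b - a)" "a \<le> b" "b - a = pile_len I j"
    using linear_pieceD[of H a b 1] linear_pieceD[of H a b "- 1"] by auto
  then have "\<bar>H b - H a\<bar> = b - a" "reclaim_len I act = b - a"
    using Reclaim by auto
  then have "\<bar>H b - H a\<bar> / travel_speed I + (1 - 1 / travel_speed I) * reclaim_len I act = b - a"
    by (simp add: left_diff_distrib)
  then show ?thesis by simp
qed

text \<open>Double counting: the contribution of a piece is spread over all stockpiles by an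
  indicator, the sums are swapped, and exactly one piece remains for each stockpile.\<close>

lemma feasible_reclaim_len:
  assumes "feasible I S"
  shows "(\<Sum>i<length (activities S). reclaim_len I (activities S ! i)) =
    (\<Sum>j=1..pile_count I. pile_len I j)"
proof -
  let ?as = "activities S" and ?J = "{1..pile_count I}"
  \<comment> \<open>Uniqueness of pieces says nothing about indices outside \<open>?J\<close>;
    \<open>performs\<close> is what excludes them.\<close>
  have range: "j \<in> ?J" if "i < length ?as" "?as ! i = Reclaim j" for i j
  proof -
    have "performs I (position S) (breakpoints S ! i) (breakpoints S ! (i + 1)) (?as ! i)"
      using assms that(1) by (auto simp: feasible_def reclaimer_schedule_def Let_def)
    then show ?thesis using that(2) by simp
  qed
  have "reclaim_len I (?as ! i) = (\<Sum>j\<in>?J. if ?as ! i = Reclaim j then pile_len I j else 0)"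
    if "i < length ?as" for i
  proof (cases "?as ! i")
    case (Reclaim j)
    with range[OF that] show ?thesis by simp
  qed auto
  then have "(\<Sum>i<length ?as. reclaim_len I (?as ! i)) =
    (\<Sum>j\<in>?J. \<Sum>i<length ?as. if ?as ! i = Reclaim j then pile_len I j else 0)"
    by (subst sum.swap) simp
  also have "\<dots> = (\<Sum>j\<in>?J. pile_len I j)"
  proof (rule sum.cong)
    fix j assume "j \<in> ?J"
    then obtain i where i: "i < length ?as" "?as ! i = Reclaim j"
      and uniq: "\<And>i'. i' < length ?as \<Longrightarrow> ?as ! i' = Reclaim j \<Longrightarrow> i' = i"
      using assms unfolding feasible_def by metis
    then have "?as ! i' = Reclaim j \<longleftrightarrow> i' = i" if "i' < length ?as" for i'
      using that by blast
    then have "(\<Sum>i'<length ?as. if ?as ! i' = Reclaim j then pile_len I j else 0) =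
      (\<Sum>i'<length ?as. if i' = i then pile_len I j else 0)"
      by (intro sum.cong) simp_all
    then show "(\<Sum>i'<length ?as. if ?as ! i' = Reclaim j then pile_len I j else 0) = pile_len I j"
      using i(1) by simp
  qed simp
  finally show ?thesis .
qed

text \<open>The triangle inequality is applied separately to the way from 0 to \<open>f k\<close>
  and to the way back.\<close>

lemma closed_walk_distance:
  fixes f :: "nat \<Rightarrow> real"
  assumes "f 0 = 0" "f m = 0" "k \<le> m"
  shows "2 * f k \<le> (\<Sum>i<m. \<bar>f (i + 1) - f i\<bar>)"
proof -
  have "f k - f 0 = (\<Sum>i<k. f (i + 1) - f i)"
    using sum_lessThan_telescope[of f k] by simp
  also have "\<dots> \<le> (\<Sum>i<k. \<bar>f (i + 1) - f i\<bar>)"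
    by (intro sum_mono) simp
  finally have 1: "f k \<le> (\<Sum>i=0..<k. \<bar>f (i + 1) - f i\<bar>)"
    using assms by (simp add: atLeast0LessThan)
  have "f k - f m = - (\<Sum>i=k..<m. f (i + 1) - f i)"
    using sum_Suc_diff'[of k m f] assms(3) by simp
  also have "\<dots> \<le> (\<Sum>i=k..<m. \<bar>f (i + 1) - f i\<bar>)"
    by (simp flip: sum_negf) (intro sum_mono, simp)
  finally have 2: "f k \<le> (\<Sum>i=k..<m. \<bar>f (i + 1) - f i\<bar>)"
    using assms by simp
  show ?thesis
    using 1 2 sum.atLeastLessThan_concat[of 0 k m "\<lambda>i. \<bar>f (i + 1) - f i\<bar>"] assms(3)
    by (simp add: atLeast0LessThan)
qed

text \<open>The bound is stated for any visited \<open>M\<close> instead of a maximum, so that it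
  can be instantiated with the value that the sweep's distance yields. The case \<open>M = 0\<close>
  serves instances without stockpiles.\<close>

lemma feasible_makespan_ge:
  assumes "feasible I S" "travel_speed I \<ge> 1"
    and M: "M = 0 \<or> (\<exists>j\<in>{1..pile_count I}. M = right_end I j)"
  shows "2 * real_of_int M / travel_speed I
      + (1 - 1 / travel_speed I) * (\<Sum>j=1..pile_count I. pile_len I j) \<le> makespan S"
proof -
  let ?s = "travel_speed I" and ?as = "activities S"
  define t where "t i = breakpoints S ! i" for i
  define f where "f i = position S (t i)" for i
  define m where "m = length ?as"
  have ends: "t 0 = 0" "t m = makespan S" "f 0 = 0" "f m = 0"
    and perf: "\<And>i. i < m \<Longrightarrow> performs I (position S) (t i) (t (i + 1)) (?as ! i)"
    using assms(1) by (auto simp: feasible_def reclaimer_schedule_def Let_def t_def f_def m_def)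
  have "\<exists>k\<le>m. f k = real_of_int M"
    using M
  proof
    assume "\<exists>j\<in>{1..pile_count I}. M = right_end I j"
    then obtain j i where j: "M = right_end I j" and i: "i < m" "?as ! i = Reclaim j"
      using assms(1) unfolding feasible_def m_def by metis
    \<comment> \<open>The right end is where the piece starts or where it stops, according to its
      direction.\<close>
    with perf[OF i(1)] have "f i = M \<or> f (i + 1) = M"
      using linear_pieceD(2)[of "position S" "t i" "t (i + 1)" 1] by (auto simp: f_def)
    with i(1) show ?thesis by (metis Suc_eq_plus1 Suc_leI less_imp_le)
  qed (use ends in auto)
  then have "2 * real_of_int M \<le> (\<Sum>i<m. \<bar>f (i + 1) - f i\<bar>)"
    using closed_walk_distance[of f m] ends by metis
  then have "2 * real_of_int M / ?s \<le> (\<Sum>i<m. \<bar>f (i + 1) - f i\<bar>) / ?s"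
    using assms(2) by (intro divide_right_mono) auto
  then have "2 * real_of_int M / ?s + (1 - 1 / ?s) * (\<Sum>j=1..pile_count I. pile_len I j)
      \<le> (\<Sum>i<m. \<bar>f (i + 1) - f i\<bar> / ?s + (1 - 1 / ?s) * reclaim_len I (?as ! i))"
    by (simp add: feasible_reclaim_len[OF assms(1)] m_def sum.distrib sum_divide_distrib
        del: One_nat_def of_int_diff flip: sum_distrib_left)
  also have "\<dots> \<le> (\<Sum>i<m. t (i + 1) - t i)"
    using performs_duration[OF perf assms(2)] by (intro sum_mono) (auto simp: f_def)
  also have "\<dots> = makespan S"
    using sum_lessThan_telescope[of t m] ends by simp
  finally show ?thesis .
qed

section \<open>Schedules given by legs\<close>

text \<open>\<open>Idle\<close> is excluded because its speed 0 would be the divisor in the duration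
  of the leg.\<close>

fun valid_leg :: "reclaim_instance \<Rightarrow> real \<Rightarrow> leg \<Rightarrow> bool" where
  "valid_leg I x (Idle, y) \<longleftrightarrow> False"
| "valid_leg I x (Travel, y) \<longleftrightarrow> True"
| "valid_leg I x (Reclaim j, y) \<longleftrightarrow> j \<in> {1..pile_count I} \<and> left_end I j < right_end I j \<and>
    (x = left_end I j \<and> y = right_end I j \<or> x = right_end I j \<and> y = left_end I j)"

fun valid_legs :: "reclaim_instance \<Rightarrow> real \<Rightarrow> leg list \<Rightarrow> bool" where
  "valid_legs I x [] \<longleftrightarrow> True"
| "valid_legs I x (leg # legs) \<longleftrightarrow>
     valid_leg I x leg \<and> 0 \<le> snd leg \<and> snd leg \<le> rail_len I \<and> valid_legs I (snd leg) legs"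

fun leg_distance :: "real \<Rightarrow> leg list \<Rightarrow> real" where
  "leg_distance x [] = 0"
| "leg_distance x ((a, y) # legs) = \<bar>y - x\<bar> + leg_distance y legs"

lemma valid_leg_speed:
  "valid_leg I x (a, y) \<Longrightarrow> travel_speed I \<ge> 1 \<Longrightarrow> activity_speed I a > 0"
  by (cases a) auto

section \<open>Times and positions along a list of legs\<close>

lemma length_leg_breakpoints [simp]:
  "length (leg_breakpoints I t x legs) = length legs + 1"
  by (induction I t x legs rule: leg_breakpoints.induct) auto

lemma leg_breakpoints_nth_0 [simp]: "leg_breakpoints I t x legs ! 0 = t"
  by (cases "(I, t, x, legs)" rule: leg_breakpoints.cases) auto

text \<open>The recursion consumes legs from the front, whereas the program appends them at the
  back. The entry of \<open>x # map snd legs\<close> at \<open>length legs\<close> is the position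
  reached so far.\<close>

lemma leg_breakpoints_snoc:
  "leg_breakpoints I t x (legs @ [(a, y)]) = leg_breakpoints I t x legs @
     [leg_breakpoints I t x legs ! length legs
        + \<bar>y - (x # map snd legs) ! length legs\<bar> / activity_speed I a]"
  by (induction I t x legs rule: leg_breakpoints.induct) auto

lemma leg_breakpoints_ge:
  assumes "valid_legs I x legs" "travel_speed I \<ge> 1" "i \<le> length legs"
  shows "t \<le> leg_breakpoints I t x legs ! i"
  using assms
proof (induction I t x legs arbitrary: i rule: leg_breakpoints.induct)
  case (2 I t x a y legs)
  then have "0 \<le> \<bar>y - x\<bar> / activity_speed I a"
    using valid_leg_speed[of I x a y] by simp
  with 2 show ?case
    by (cases i) (force intro: order_trans[of t "t + \<bar>y - x\<bar> / activity_speed I a"])+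
qed simp

lemma leg_position_0 [simp]:
  assumes "valid_legs I x legs" "travel_speed I \<ge> 1"
  shows "leg_position I x legs 0 = x"
proof (cases legs)
  case (Cons leg legs')
  then show ?thesis
    using assms valid_leg_speed[of I x "fst leg" "snd leg"] by (cases leg) (auto simp: Let_def)
qed simp

lemma leg_end:
  assumes "(v :: real) > 0"
  shows "x + sgn (y - x) * v * (\<bar>y - x\<bar> / v) = y"
proof -
  have "sgn (y - x) * v * (\<bar>y - x\<bar> / v) = sgn (y - x) * \<bar>y - x\<bar>"
    using assms by simp
  then show ?thesis by (simp add: sgn_mult_abs)
qed

text \<open>At the junction time itself the definition still uses the first leg. That leg has
  arrived at \<open>y\<close> by then, so the rest of the list may take over on the closed
  half-line.\<close>

lemma leg_position_later:
  assumes "valid_legs I x ((a, y) # legs)" "travel_speed I \<ge> 1"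
    and "\<bar>y - x\<bar> / activity_speed I a \<le> t"
  shows "leg_position I x ((a, y) # legs) t =
    leg_position I y legs (t - \<bar>y - x\<bar> / activity_speed I a)"
proof (cases "t = \<bar>y - x\<bar> / activity_speed I a")
  case True
  then show ?thesis
    using assms leg_end[of "activity_speed I a" x y] valid_leg_speed[of I x a y]
    by (simp add: Let_def)
qed (use assms in \<open>simp add: Let_def\<close>)

text \<open>Breakpoints are absolute times, but \<open>leg_position\<close> counts time from the
  start of its list. Inductions therefore speak of any \<open>H\<close> that agrees with the shifted
  position from \<open>t\<close> on; this lemma passes that premise to the tail.\<close>

lemma leg_position_rest:
  assumes "valid_legs I x ((a, y) # legs)" "travel_speed I \<ge> 1"
    and H: "\<And>u. u \<ge> t \<Longrightarrow> H u = leg_position I x ((a, y) # legs) (u - t)"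
    and u: "u \<ge> t + \<bar>y - x\<bar> / activity_speed I a"
  shows "H u = leg_position I y legs (u - (t + \<bar>y - x\<bar> / activity_speed I a))"
proof -
  let ?d = "\<bar>y - x\<bar> / activity_speed I a"
  have "0 \<le> ?d" using assms(1,2) valid_leg_speed[of I x a y] by simp
  with u have "u \<ge> t" "?d \<le> u - t" by linarith+
  with H leg_position_later[OF assms(1,2)] show ?thesis
    by (metis diff_diff_eq)
qed

lemma leg_position_breakpoint:
  assumes "valid_legs I x legs" "travel_speed I \<ge> 1" "i \<le> length legs"
    and "\<And>u. u \<ge> t \<Longrightarrow> H u = leg_position I x legs (u - t)"
  shows "H (leg_breakpoints I t x legs ! i) = (x # map snd legs) ! i"
  using assms
proof (induction I t x legs arbitrary: i rule: leg_breakpoints.induct)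
  case (2 I t x a y legs)
  let ?d = "\<bar>y - x\<bar> / activity_speed I a"
  note step = "2.IH"[OF _ _ _ leg_position_rest[OF "2.prems"(1,2,4)]]
  show ?case
  proof (cases i)
    case 0
    then show ?thesis
      using "2.prems" by (simp del: leg_position.simps)
  next
    case (Suc i')
    then show ?thesis using "2.prems" step[of i'] by simp
  qed
qed simp

lemma leg_performs:
  assumes v: "valid_leg I x (a, y)" and s: "travel_speed I \<ge> 1"
    and H: "\<And>u. t \<le> u \<Longrightarrow> u \<le> t + \<bar>y - x\<bar> / activity_speed I a \<Longrightarrow>
      H u = x + sgn (y - x) * activity_speed I a * (u - t)"
  shows "performs I H t (t + \<bar>y - x\<bar> / activity_speed I a) a"
proof -
  have d: "0 \<le> \<bar>y - x\<bar> / activity_speed I a" using valid_leg_speed[OF v s] by simp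
  then have Ht: "H t = x" using H[of t] by simp
  show ?thesis
  proof (cases a)
    case Idle
    then show ?thesis using v by simp
  next
    case Travel
    \<comment> \<open>For \<open>y = x\<close> the formula has slope \<open>sgn 0 = 0\<close>
      instead of the travel speed, but the interval is then a single point and any slope
      fits.\<close>
    then show ?thesis
      using H d Ht by (cases "y = x"; cases "y < x") (auto simp: linear_piece_def sgn_if)
  next
    case (Reclaim j)
    then show ?thesis
      using H d Ht v by (auto simp: linear_piece_def)
  qed
qed

lemma legs_perform:
  assumes "valid_legs I x legs" "travel_speed I \<ge> 1" "i < length legs"
    and "\<And>u. u \<ge> t \<Longrightarrow> H u = leg_position I x legs (u - t)"
  shows "performs I H (leg_breakpoints I t x legs ! i) (leg_breakpoints I t x legs ! (i + 1))
    (fst (legs ! i))"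
  using assms
proof (induction I t x legs arbitrary: i rule: leg_breakpoints.induct)
  case (2 I t x a y legs)
  let ?d = "\<bar>y - x\<bar> / activity_speed I a"
  note step = "2.IH"[OF _ _ _ leg_position_rest[OF "2.prems"(1,2,4)]]
  show ?case
  proof (cases i)
    case 0
    have "performs I H t (t + ?d) a"
      using "2.prems" by (intro leg_performs) (auto simp: Let_def)
    with 0 show ?thesis by simp
  next
    case (Suc i')
    then show ?thesis using "2.prems" step[of i'] by simp
  qed
qed simp

text \<open>Two closed half-lines are glued at the end of the first leg. Working on
  \<open>UNIV\<close> keeps the shift by \<open>d\<close> free of domain conditions.\<close>

lemma leg_position_continuous:
  assumes "valid_legs I x legs" "travel_speed I \<ge> 1"
  shows "continuous_on UNIV (leg_position I x legs)"
  using assms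
proof (induction legs arbitrary: x)
  case (Cons leg legs)
  obtain a y where leg: "leg = (a, y)" by force
  define v where "v = activity_speed I a"
  define d where "d = \<bar>y - x\<bar> / v"
  have end_leg: "x + sgn (y - x) * v * d = y"
    using Cons.prems leg leg_end[of v x y] valid_leg_speed[of I x a y]
    by (simp add: v_def d_def)
  have rest: "continuous_on UNIV (leg_position I y legs)" "leg_position I y legs 0 = y"
    using Cons leg by auto
  have later: "continuous_on {d..} (\<lambda>t. leg_position I y legs (t - d))"
    by (rule continuous_on_compose2[OF rest(1), of _ "\<lambda>t. t - d"])
      (auto intro: continuous_on_diff continuous_on_id continuous_on_const)
  have "continuous_on ({..d} \<union> {d..}) (\<lambda>t. if t \<le> d
      then x + sgn (y - x) * v * t else leg_position I y legs (t - d))"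
  proof (rule continuous_on_cases[OF _ _ _ later])
    show "continuous_on {..d} (\<lambda>t. x + sgn (y - x) * v * t)"
      by (intro continuous_on_add continuous_on_mult continuous_on_const continuous_on_id)
    show "\<forall>t. t \<in> {..d} \<and> \<not> t \<le> d \<or> t \<in> {d..} \<and> t \<le> d \<longrightarrow>
        x + sgn (y - x) * v * t = leg_position I y legs (t - d)"
      using end_leg rest(2) by auto
  qed auto
  moreover have "{..d} \<union> {d..} = UNIV" by auto
  moreover have "leg_position I x (leg # legs) = (\<lambda>t. if t \<le> d
      then x + sgn (y - x) * v * t else leg_position I y legs (t - d))"
    by (rule ext) (simp add: leg v_def d_def Let_def)
  ultimately show ?case by simp
qed simp

lemma leg_position_range:
  assumes "valid_legs I x legs" "travel_speed I \<ge> 1" "0 \<le> x" "x \<le> rail_len I" "0 \<le> t"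
  shows "0 \<le> leg_position I x legs t \<and> leg_position I x legs t \<le> rail_len I"
  using assms
proof (induction legs arbitrary: x t)
  case (Cons leg legs)
  obtain a y where leg: "leg = (a, y)" by force
  let ?v = "activity_speed I a"
  let ?d = "\<bar>y - x\<bar> / ?v"
  have v: "?v > 0" using Cons leg valid_leg_speed[of I x a y] by auto
  show ?case
  proof (cases "t \<le> ?d")
    case True
    then have "?v * t \<le> \<bar>y - x\<bar>" "0 \<le> ?v * t" using v Cons.prems by (auto simp: field_simps)
    then have "min x y \<le> x + sgn (y - x) * ?v * t" "x + sgn (y - x) * ?v * t \<le> max x y"
      by (auto simp: sgn_if min_def max_def)
    then show ?thesis using True Cons.prems leg by (auto simp: Let_def)
  next
    case False
    then show ?thesis using Cons.prems leg Cons.IH[of y "t - ?d"] by (simp add: Let_def)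
  qed
qed simp

text \<open>This is the exact counterpart of \<open>performs_duration\<close>, summed over legs,
  none of which idles.\<close>

lemma legs_makespan:
  assumes "valid_legs I x legs" "travel_speed I \<ge> 1"
  shows "leg_breakpoints I t x legs ! length legs = t + leg_distance x legs / travel_speed I
    + (1 - 1 / travel_speed I) * (\<Sum>i<length legs. reclaim_len I (fst (legs ! i)))"
  using assms
proof (induction I t x legs rule: leg_breakpoints.induct)
  case (2 I t x a y legs)
  define c where "c = 1 - 1 / travel_speed I"
  let ?d = "\<bar>y - x\<bar> / activity_speed I a"
  let ?R = "\<Sum>i<length legs. reclaim_len I (fst (legs ! i))"
  have "?d = \<bar>y - x\<bar> / travel_speed I + c * reclaim_len I a"
    using "2.prems" by (cases a) (auto simp: c_def field_simps)
  moreover have "leg_breakpoints I (t + ?d) y legs ! length legs =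
      t + ?d + leg_distance y legs / travel_speed I + c * ?R"
    using 2 by (simp add: c_def)
  moreover have "(\<Sum>i<length ((a, y) # legs). reclaim_len I (fst (((a, y) # legs) ! i))) =
      reclaim_len I a + ?R"
    by (simp add: sum.lessThan_Suc_shift del: sum.lessThan_Suc)
  ultimately show ?case
    by (simp add: distrib_left add_divide_distrib flip: c_def)
qed simp

lemma leg_distance_append:
  "leg_distance x (legs @ legs') =
     leg_distance x legs + leg_distance (last (x # map snd legs)) legs'"
  by (induction x legs rule: leg_distance.induct) auto

section \<open>The sweep\<close>

text \<open>A single list for both pads lets one loop counter run through the whole sweep.\<close>

definition sweep_order :: "reclaim_instance \<Rightarrow> nat list" where
  "sweep_order I = [1..<pad1_count I + 1] @ rev [pad1_count I + 1..<pile_count I + 1]"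

definition pile_legs :: "reclaim_instance \<Rightarrow> nat \<Rightarrow> leg list" where
  "pile_legs I j = (if j \<le> pad1_count I
     then [(Travel, left_end I j), (Reclaim j, right_end I j)]
     else [(Travel, right_end I j), (Reclaim j, left_end I j)])"

lemma sweep_legs_eq:
  "sweep_legs I = concat (map (pile_legs I) (sweep_order I)) @ [(Travel, 0)]"
proof -
  have "map (pile_legs I) [1..<pad1_count I + 1] =
      map (\<lambda>j. [(Travel, real_of_int (left_end I j)), (Reclaim j, real_of_int (right_end I j))])
        [1..<pad1_count I + 1]"
    by (intro map_cong) (auto simp: pile_legs_def)
  moreover have "map (pile_legs I) (rev [pad1_count I + 1..<pile_count I + 1]) =
      map (\<lambda>j. [(Travel, real_of_int (right_end I j)), (Reclaim j, real_of_int (left_end I j))])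
        (rev [pad1_count I + 1..<pile_count I + 1])"
    by (intro map_cong) (auto simp: pile_legs_def)
  ultimately show ?thesis
    by (simp only: sweep_legs_def sweep_order_def Let_def map_append concat_append append_assoc)
qed

lemma sweep_order_props:
  assumes "pad1_count I \<le> pile_count I"
  shows "length (sweep_order I) = pile_count I" "set (sweep_order I) = {1..pile_count I}"
    "distinct (sweep_order I)"
  using assms by (auto simp: sweep_order_def simp del: upt_Suc)

text \<open>On the second pad, entry \<open>k - pad1_count I\<close> of the descending list is
  \<open>pile_count I - (k - pad1_count I)\<close>. The program computes the index in the
  subtraction-safe form given here.\<close>

lemma sweep_order_nth:
  assumes "k < pile_count I"
  shows "sweep_order I ! k =
    (if k < pad1_count I then k + 1 else pile_count I + pad1_count I - k)"
  using assms by (auto simp: sweep_order_def nth_append rev_nth simp del: upt_Suc)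

text \<open>Each \<open>Reclaim\<close> leg follows a \<open>Travel\<close> leg to its starting end,
  so the induction can handle arbitrary lists of stockpiles and arbitrary starting points.\<close>

lemma valid_sweep_legs:
  assumes "valid_instance I"
  shows "valid_legs I x (sweep_legs I)"
proof -
  have "valid_legs I x (concat (map (pile_legs I) js) @ [(Travel, 0)])"
    if "set js \<subseteq> {1..pile_count I}" for js
    using that
  proof (induction js arbitrary: x)
    case (Cons j js)
    then have "0 \<le> left_end I j \<and> left_end I j < right_end I j \<and> right_end I j \<le> rail_len I"
      using assms by (auto simp: valid_instance_def)
    with Cons show ?case by (auto simp: pile_legs_def)
  qed (use assms in \<open>simp add: valid_instance_def\<close>)
  then show ?thesis
    using assms sweep_order_props[of I] by (simp add: sweep_legs_eq valid_instance_def)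
qed

lemma ex1_nth_of_count_list_1:
  assumes "count_list xs y = 1"
  shows "\<exists>!i. i < length xs \<and> xs ! i = y"
proof -
  have "card {i. i < length xs \<and> y = xs ! i} = 1"
    using assms by (simp add: count_list_eq_length_filter length_filter_conv_card)
  then obtain i where i: "{i. i < length xs \<and> y = xs ! i} = {i}"
    by (rule card_1_singletonE)
  have "k < length xs \<and> xs ! k = y \<longleftrightarrow> k = i" for k
    using eqset_imp_iff[OF i, of k] by auto
  then show ?thesis by simp
qed

text \<open>Counting occurrences is additive over concatenation, and \<open>pile_legs\<close>
  contributes one \<open>Reclaim\<close> per entry of the order.\<close>

lemma sweep_activities_unique:
  assumes "distinct (sweep_order I)" "j \<in> set (sweep_order I)"
  shows "\<exists>!i. i < length (sweep_legs I) \<and> map fst (sweep_legs I) ! i = Reclaim j"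
proof -
  have "count_list (map fst (concat (map (pile_legs I) js) @ [(Travel, 0)])) (Reclaim j) =
    count_list js j" for js
    by (induction js) (auto simp: pile_legs_def)
  moreover have "distinct js \<Longrightarrow> j \<in> set js \<Longrightarrow> count_list js j = 1" for js
    by (induction js) auto
  ultimately have "count_list (map fst (sweep_legs I)) (Reclaim j) = 1"
    using assms by (simp only: sweep_legs_eq)
  from ex1_nth_of_count_list_1[OF this] show ?thesis by simp
qed

lemma sweep_distance:
  assumes "valid_instance I"
  shows "\<exists>M. (M = 0 \<or> (\<exists>j\<in>{1..pile_count I}. M = right_end I j)) \<and>
    leg_distance 0 (sweep_legs I) = 2 * real_of_int M"
proof -
  let ?l = "\<lambda>j. real_of_int (left_end I j)" and ?r = "\<lambda>j. real_of_int (right_end I j)"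
  let ?a = "pad1_count I"
  let ?up = "\<lambda>j. [(Travel, ?l j), (Reclaim j, ?r j)]"
  let ?down = "\<lambda>j. [(Travel, ?r j), (Reclaim j, ?l j)]"
  have bounds: "0 \<le> ?l j" "?l j < ?r j" if "j \<in> {1..pile_count I}" for j
    using assms that by (auto simp: valid_instance_def)
  \<comment> \<open>The end position is carried along because the next distance starts from
    it.\<close>
  have up: "leg_distance 0 (concat (map ?up [1..<m + 1])) = (if m = 0 then 0 else ?r m) \<and>
      last (0 # map snd (concat (map ?up [1..<m + 1]))) = (if m = 0 then 0 else ?r m)"
    if "m \<le> ?a" for m
    using that
  proof (induction m)
    case (Suc m)
    have "m \<noteq> 0 \<Longrightarrow> ?r m \<le> ?l (Suc m)"
      using assms Suc.prems by (auto simp: valid_instance_def)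
    moreover have "Suc m \<in> {1..pile_count I}"
      using assms Suc.prems by (auto simp: valid_instance_def)
    ultimately show ?case
      using Suc bounds[of "Suc m"] by (cases "m = 0") (auto simp: leg_distance_append)
  qed simp
  \<comment> \<open>The induction adds stockpile \<open>Suc m\<close>, which comes first in the
    reversed list; the remaining legs then start at its left end, hence the arbitrary
    \<open>x\<close>. Including the final leg to 0 makes the downward distances telescope to
    \<open>?r m\<close>.\<close>
  have down: "leg_distance x (concat (map ?down (rev [?a + 1..<m + 1])) @ [(Travel, 0)]) =
      (if m = ?a then x else \<bar>?r m - x\<bar> + ?r m)"
    if "?a \<le> m" "m \<le> pile_count I" "0 \<le> x" for m x
    using that
  proof (induction m arbitrary: x rule: dec_induct)
    case (step m)
    have "m \<noteq> ?a \<Longrightarrow> ?r m \<le> ?l (Suc m)"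
      using assms step by (auto simp: valid_instance_def)
    then show ?case
      using step bounds[of "Suc m"] by auto
  qed simp
  \<comment> \<open>The defaults 0 and \<open>A\<close> for empty pads put all cases into the form A
    + |B - A| + B.\<close>
  define A where "A = (if ?a = 0 then 0 else right_end I ?a)"
  define B where "B = (if pile_count I = ?a then A else right_end I (pile_count I))"
  have le: "?a \<le> pile_count I" using assms by (simp add: valid_instance_def)
  have A: "A = 0 \<or> (\<exists>j\<in>{1..pile_count I}. A = right_end I j)" "0 \<le> A"
    using le bounds[of ?a] by (auto simp: A_def)
  have B: "B = A \<or> (\<exists>j\<in>{1..pile_count I}. B = right_end I j)"
    using le by (auto simp: B_def)
  have up_A: "leg_distance 0 (concat (map ?up [1..<?a + 1])) = A"
    "last (0 # map snd (concat (map ?up [1..<?a + 1]))) = A"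
    using up[OF order_refl] by (auto simp only: A_def of_int_0 split: if_split)
  have down_A: "leg_distance A (concat (map ?down (rev [?a + 1..<pile_count I + 1])) @ [(Travel, 0)]) =
      (if pile_count I = ?a then A else \<bar>?r (pile_count I) - A\<bar> + ?r (pile_count I))"
    using down[OF le order_refl] A(2) by (simp only: of_int_0_le_iff)
  have "leg_distance 0 (sweep_legs I) =
      A + (if pile_count I = ?a then A else \<bar>?r (pile_count I) - A\<bar> + ?r (pile_count I))"
    by (simp only: sweep_legs_def Let_def leg_distance_append[of 0 "concat (map ?up [1..<?a + 1])"]
        up_A down_A)
  then have "leg_distance 0 (sweep_legs I) = 2 * real_of_int (max A B)"
    by (auto simp: B_def max_def)
  then show ?thesis using A B by (intro exI[of _ "max A B"]) (auto simp: max_def)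
qed

lemma sweep_feasible:
  assumes "valid_instance I"
  shows "feasible I (sweep I)"
proof -
  let ?legs = "sweep_legs I"
  let ?C = "leg_breakpoints I 0 0 ?legs ! length ?legs"
  have s: "travel_speed I \<ge> 1" and le: "pad1_count I \<le> pile_count I" and L: "0 \<le> rail_len I"
    using assms by (auto simp: valid_instance_def)
  note v = valid_sweep_legs[OF assms, of 0]
  have C: "makespan (sweep I) = ?C"
    using length_leg_breakpoints[of I 0 0 ?legs]
    by (simp add: sweep_def last_conv_nth flip: length_greater_0_conv)
  have "leg_position I 0 ?legs ?C = (0 # map snd ?legs) ! length ?legs"
    using leg_position_breakpoint[OF v s order_refl, of 0 "leg_position I 0 ?legs"] by simp
  also have "\<dots> = 0"
    by (simp add: sweep_legs_eq nth_append)
  finally have "leg_position I 0 ?legs ?C = 0" .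
  moreover have "continuous_on {0..?C} (leg_position I 0 ?legs)"
    using leg_position_continuous[OF v s] continuous_on_subset by blast
  moreover have "leg_position I 0 ?legs ` {0..?C} \<subseteq> {0..rail_len I}"
  proof (rule image_subsetI)
    fix t assume "t \<in> {0..?C}"
    then show "leg_position I 0 ?legs t \<in> {0..rail_len I}"
      using leg_position_range[OF v s, of t] L by simp
  qed
  moreover have "performs I (leg_position I 0 ?legs) (leg_breakpoints I 0 0 ?legs ! i)
      (leg_breakpoints I 0 0 ?legs ! (i + 1)) (fst (?legs ! i))" if "i < length ?legs" for i
    using legs_perform[OF v s that] by simp
  ultimately have "reclaimer_schedule I 0 (sweep I)"
    using leg_breakpoints_ge[OF v s order_refl] v s C
    unfolding reclaimer_schedule_def Let_def C by (simp add: sweep_def)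
  moreover have "\<exists>!i. i < length (activities (sweep I)) \<and> activities (sweep I) ! i = Reclaim j"
    if "j \<in> {1..pile_count I}" for j
    using sweep_activities_unique[of I j] sweep_order_props[OF le] that
    by (simp add: sweep_def)
  ultimately show ?thesis by (simp add: feasible_def)
qed

lemma sweep_optimal:
  assumes "valid_instance I"
  shows "optimal I (sweep I)"
proof -
  let ?legs = "sweep_legs I"
  have s: "travel_speed I \<ge> 1" using assms by (simp add: valid_instance_def)
  obtain M where M: "M = 0 \<or> (\<exists>j\<in>{1..pile_count I}. M = right_end I j)"
    and dist: "leg_distance 0 ?legs = 2 * real_of_int M"
    using sweep_distance[OF assms] by blast
  have "makespan (sweep I) = leg_breakpoints I 0 0 ?legs ! length ?legs"
    using length_leg_breakpoints[of I 0 0 ?legs]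
    by (simp add: sweep_def last_conv_nth flip: length_greater_0_conv)
  \<comment> \<open>Being feasible, the sweep itself falls under
    \<open>feasible_reclaim_len\<close>, which turns the sum over its legs into the sum in the lower
    bound.\<close>
  also have "\<dots> = 2 * real_of_int M / travel_speed I
      + (1 - 1 / travel_speed I) * (\<Sum>j=1..pile_count I. pile_len I j)"
    using legs_makespan[OF valid_sweep_legs[OF assms] s, of 0 0] dist
      feasible_reclaim_len[OF sweep_feasible[OF assms]]
    by (simp add: sweep_def)
  finally show ?thesis
    using sweep_feasible[OF assms] feasible_makespan_ge[OF _ s M] by (auto simp: optimal_def)
qed

section \<open>The linear-time program\<close>

abbreviation nvar :: "string \<Rightarrow> nexp" where
  "nvar x \<equiv> NCell x (NConst 0)"

text \<open>The test replaces the absolute value, which the expressions do not offer. The counter is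
  incremented last since all addresses derive from its old value.\<close>

definition emit :: "nexp \<Rightarrow> rexp \<Rightarrow> rexp \<Rightarrow> com" where
  "emit a y v =
    (let m = nvar ''m''; m' = NPlus m (NConst 1); x = RCell ''x'' m; x' = RCell ''x'' m' in
     Seq (NAssign ''act'' m a)
    (Seq (RAssign ''x'' m' y)
    (Seq (Cond (RLess x x')
            (RAssign ''t'' m' (RPlus (RCell ''t'' m) (RDiv (RMinus x' x) v)))
            (RAssign ''t'' m' (RPlus (RCell ''t'' m) (RDiv (RMinus x x') v))))
         (NAssign ''m'' (NConst 0) m'))))"

text \<open>The values 1 and \<open>j + 2\<close> are the activity codes of \<open>Travel\<close>
  and \<open>Reclaim j\<close>.\<close>

definition emit_pile :: "nexp \<Rightarrow> string \<Rightarrow> string \<Rightarrow> com" where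
  "emit_pile e from to =
     Seq (NAssign ''j'' (NConst 0) e)
    (Seq (emit (NConst 1) (RCell from (nvar ''j'')) (RCell ''s'' (NConst 0)))
         (emit (NPlus (nvar ''j'') (NConst 2)) (RCell to (nvar ''j'')) (RConst 1)))"

definition sweep_body :: com where
  "sweep_body = Seq
    (Cond (NLess (nvar ''k'') (nvar ''n1''))
      (emit_pile (NPlus (nvar ''k'') (NConst 1)) ''l'' ''r'')
      (emit_pile (NMinus (NPlus (nvar ''n'') (nvar ''n1'')) (nvar ''k'')) ''r'' ''l''))
    (NAssign ''k'' (NConst 0) (NPlus (nvar ''k'') (NConst 1)))"

definition sweep_loop :: com where
  "sweep_loop = While (NLess (nvar ''k'') (nvar ''n'')) sweep_body"

definition sweep_prog :: com where
  "sweep_prog = Seq sweep_loop (emit (NConst 1) (RConst 0) (RCell ''s'' (NConst 0)))"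

text \<open>Positions are given by the ends of legs rather than by \<open>leg_position\<close>, so
  that appending a leg leaves the earlier entries untouched.\<close>

definition emitted :: "reclaim_instance \<Rightarrow> leg list \<Rightarrow> store \<Rightarrow> bool" where
  "emitted I legs \<sigma> \<longleftrightarrow>
     ncells \<sigma> ''m'' 0 = length legs \<and>
     (\<forall>i<length legs. ncells \<sigma> ''act'' i = activity_code (fst (legs ! i))) \<and>
     (\<forall>i\<le>length legs. rcells \<sigma> ''t'' i = leg_breakpoints I 0 0 legs ! i \<and>
        rcells \<sigma> ''x'' i = (0 # map snd legs) ! i)"

definition same_vars :: "store \<Rightarrow> store \<Rightarrow> bool" where
  "same_vars \<sigma> \<tau> \<longleftrightarrow>
     (\<forall>x. x \<noteq> ''act'' \<longrightarrow> x \<noteq> ''m'' \<longrightarrow> ncells \<tau> x = ncells \<sigma> x) \<and>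
     (\<forall>x. x \<noteq> ''x'' \<longrightarrow> x \<noteq> ''t'' \<longrightarrow> rcells \<tau> x = rcells \<sigma> x)"

definition holds_input :: "reclaim_instance \<Rightarrow> store \<Rightarrow> bool" where
  "holds_input I \<sigma> \<longleftrightarrow>
     ncells \<sigma> ''n'' 0 = pile_count I \<and> ncells \<sigma> ''n1'' 0 = pad1_count I \<and>
     rcells \<sigma> ''s'' 0 = travel_speed I \<and>
     (\<forall>j\<in>{1..pile_count I}. rcells \<sigma> ''l'' j = left_end I j \<and> rcells \<sigma> ''r'' j = right_end I j)"

section \<open>Execution of the program and its step count\<close>

lemma runs_NAssignI:
  assumes "nval i \<sigma> = k" "nval e \<sigma> = v"
  shows "runs (NAssign x i e) \<sigma> 1 (\<sigma>\<lparr>ncells := set_cell (ncells \<sigma>) x k v\<rparr>)"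
  using assms runs_NAssign by blast

lemma runs_RAssignI:
  assumes "nval i \<sigma> = k" "rval e \<sigma> = v"
  shows "runs (RAssign x i e) \<sigma> 1 (\<sigma>\<lparr>rcells := set_cell (rcells \<sigma>) x k v\<rparr>)"
  using assms runs_RAssign by blast

text \<open>The expressions \<open>ye\<close> and \<open>ve\<close> are evaluated after output cells
  have changed, hence the assumptions for all stores that agree outside the output arrays. The test
  and the four assignments executed make 5 steps.\<close>

lemma runs_emit:
  assumes "emitted I legs \<sigma>"
    and a: "nval e \<sigma> = activity_code a"
    and y: "\<And>\<tau>. same_vars \<sigma> \<tau> \<Longrightarrow> rval ye \<tau> = y"
    and v: "\<And>\<tau>. same_vars \<sigma> \<tau> \<Longrightarrow> rval ve \<tau> = activity_speed I a"
  shows "\<exists>\<tau>. runs (emit e ye ve) \<sigma> 5 \<tau> \<and> same_vars \<sigma> \<tau> \<and> emitted I (legs @ [(a, y)]) \<tau>"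
proof -
  let ?k = "length legs"
  let ?x = "(0 # map snd legs) ! ?k"
  let ?t = "leg_breakpoints I 0 0 legs ! ?k + \<bar>y - ?x\<bar> / activity_speed I a"
  have m: "ncells \<sigma> ''m'' 0 = ?k" and t: "rcells \<sigma> ''t'' ?k = leg_breakpoints I 0 0 legs ! ?k"
    and x: "rcells \<sigma> ''x'' ?k = ?x"
    using assms(1) by (auto simp: emitted_def)
  define \<sigma>1 where "\<sigma>1 = \<sigma>\<lparr>ncells := set_cell (ncells \<sigma>) ''act'' ?k (activity_code a)\<rparr>"
  define \<sigma>2 where "\<sigma>2 = \<sigma>1\<lparr>rcells := set_cell (rcells \<sigma>1) ''x'' (?k + 1) y\<rparr>"
  define \<sigma>3 where "\<sigma>3 = \<sigma>2\<lparr>rcells := set_cell (rcells \<sigma>2) ''t'' (?k + 1) ?t\<rparr>"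
  define \<sigma>4 where "\<sigma>4 = \<sigma>3\<lparr>ncells := set_cell (ncells \<sigma>3) ''m'' 0 (?k + 1)\<rparr>"
  have same: "same_vars \<sigma> \<sigma>1" "same_vars \<sigma> \<sigma>2" "same_vars \<sigma> \<sigma>4"
    by (auto simp: same_vars_def \<sigma>1_def \<sigma>2_def \<sigma>3_def \<sigma>4_def set_cell_def)
  have vals: "ncells \<sigma>1 ''m'' 0 = ?k" "ncells \<sigma>2 ''m'' 0 = ?k" "ncells \<sigma>3 ''m'' 0 = ?k"
    "rcells \<sigma>2 ''x'' ?k = ?x" "rcells \<sigma>2 ''x'' (Suc ?k) = y"
    "rcells \<sigma>2 ''t'' ?k = leg_breakpoints I 0 0 legs ! ?k"
    using m x t by (auto simp: \<sigma>1_def \<sigma>2_def \<sigma>3_def set_cell_def)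
  let ?m = "nvar ''m''"
  let ?m' = "NPlus ?m (NConst 1)"
  have r1: "runs (NAssign ''act'' ?m e) \<sigma> 1 \<sigma>1"
    unfolding \<sigma>1_def using m a by (intro runs_NAssignI) auto
  have r2: "runs (RAssign ''x'' ?m' ye) \<sigma>1 1 \<sigma>2"
    unfolding \<sigma>2_def using y[OF same(1)] vals by (intro runs_RAssignI) auto
  have r3: "runs (Cond (RLess (RCell ''x'' ?m) (RCell ''x'' ?m'))
      (RAssign ''t'' ?m' (RPlus (RCell ''t'' ?m) (RDiv (RMinus (RCell ''x'' ?m') (RCell ''x'' ?m)) ve)))
      (RAssign ''t'' ?m' (RPlus (RCell ''t'' ?m) (RDiv (RMinus (RCell ''x'' ?m) (RCell ''x'' ?m')) ve))))
      \<sigma>2 (1 + 1) \<sigma>3" (is "runs (Cond ?b ?p ?q) _ _ _")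
  proof (cases "?x < y")
    case True
    then have "runs ?p \<sigma>2 1 \<sigma>3"
      unfolding \<sigma>3_def using v[OF same(2)] vals by (intro runs_RAssignI) auto
    moreover have "bval ?b \<sigma>2" using True vals by simp
    ultimately show ?thesis by (rule runs_CondTrue[rotated])
  next
    case False
    then have "runs ?q \<sigma>2 1 \<sigma>3"
      unfolding \<sigma>3_def using v[OF same(2)] vals by (intro runs_RAssignI) auto
    moreover have "\<not> bval ?b \<sigma>2" using False vals by simp
    ultimately show ?thesis by (rule runs_CondFalse[rotated])
  qed
  have r4: "runs (NAssign ''m'' (NConst 0) ?m') \<sigma>3 1 \<sigma>4"
    unfolding \<sigma>4_def using vals by (intro runs_NAssignI) auto
  have "runs (emit e ye ve) \<sigma> 5 \<sigma>4"
    using runs_Seq[OF r1 runs_Seq[OF r2 runs_Seq[OF r3 r4]]] by (simp add: emit_def Let_def del: One_nat_def)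
  moreover have "emitted I (legs @ [(a, y)]) \<sigma>4"
    using assms(1) unfolding emitted_def leg_breakpoints_snoc
    by (auto simp: \<sigma>1_def \<sigma>2_def \<sigma>3_def \<sigma>4_def set_cell_def nth_append le_Suc_eq less_Suc_eq
        nth_Cons')
  ultimately show ?thesis using same by blast
qed

text \<open>Restricting the array names to the two inputs ensures that emitting a leg does not alter
  them. The cost is 1 + 5 + 5.\<close>

lemma runs_emit_pile:
  assumes "emitted I legs \<sigma>" "holds_input I \<sigma>" "j = nval e \<sigma>"
    and "from \<in> {''l'', ''r''}" "to \<in> {''l'', ''r''}"
  shows "\<exists>\<tau>. runs (emit_pile e from to) \<sigma> 11 \<tau> \<and> holds_input I \<tau> \<and>
    ncells \<tau> ''k'' = ncells \<sigma> ''k'' \<and>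
    emitted I (legs @ [(Travel, rcells \<sigma> from j), (Reclaim j, rcells \<sigma> to j)]) \<tau>"
proof -
  define \<sigma>1 where "\<sigma>1 = \<sigma>\<lparr>ncells := set_cell (ncells \<sigma>) ''j'' 0 j\<rparr>"
  have r1: "runs (NAssign ''j'' (NConst 0) e) \<sigma> 1 \<sigma>1"
    unfolding \<sigma>1_def using assms(3) by (intro runs_NAssignI) auto
  have e1: "emitted I legs \<sigma>1"
    using assms(1) by (simp add: \<sigma>1_def emitted_def set_cell_def)
  have j: "ncells \<tau> ''j'' 0 = j" if "same_vars \<sigma>1 \<tau>" for \<tau>
    using that by (simp add: same_vars_def \<sigma>1_def set_cell_def)
  have rc: "rcells \<tau> ''l'' = rcells \<sigma> ''l''" "rcells \<tau> ''r'' = rcells \<sigma> ''r''"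
    "rcells \<tau> ''s'' = rcells \<sigma> ''s''" if "same_vars \<sigma>1 \<tau>" for \<tau>
    using that by (simp_all add: same_vars_def \<sigma>1_def)
  have s: "rcells \<sigma> ''s'' 0 = travel_speed I"
    using assms(2) by (simp add: holds_input_def)
  have from_val: "rval (RCell from (nvar ''j'')) \<tau> = rcells \<sigma> from j" if "same_vars \<sigma>1 \<tau>" for \<tau>
    using assms(4) j[OF that] rc[OF that] by (elim insertE) simp_all
  have to_val: "rval (RCell to (nvar ''j'')) \<tau> = rcells \<sigma> to j" if "same_vars \<sigma>1 \<tau>" for \<tau>
    using assms(5) j[OF that] rc[OF that] by (elim insertE) simp_all
  have "\<exists>\<tau>. runs (emit (NConst 1) (RCell from (nvar ''j'')) (RCell ''s'' (NConst 0))) \<sigma>1 5 \<tau> \<and>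
      same_vars \<sigma>1 \<tau> \<and> emitted I (legs @ [(Travel, rcells \<sigma> from j)]) \<tau>"
    by (rule runs_emit[OF e1 _ from_val]) (simp_all add: rc s)
  then obtain \<sigma>2 where
    r2: "runs (emit (NConst 1) (RCell from (nvar ''j'')) (RCell ''s'' (NConst 0))) \<sigma>1 5 \<sigma>2"
    and s2: "same_vars \<sigma>1 \<sigma>2" and e2: "emitted I (legs @ [(Travel, rcells \<sigma> from j)]) \<sigma>2"
    by blast
  have trans: "same_vars \<sigma>1 \<tau>" if "same_vars \<sigma>2 \<tau>" for \<tau>
    using s2 that by (simp add: same_vars_def)
  have "\<exists>\<tau>. runs (emit (NPlus (nvar ''j'') (NConst 2)) (RCell to (nvar ''j'')) (RConst 1)) \<sigma>2 5 \<tau> \<and>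
      same_vars \<sigma>2 \<tau> \<and>
      emitted I ((legs @ [(Travel, rcells \<sigma> from j)]) @ [(Reclaim j, rcells \<sigma> to j)]) \<tau>"
    by (rule runs_emit[OF e2 _ to_val]) (simp_all add: j s2 trans)
  then obtain \<sigma>3 where
    r3: "runs (emit (NPlus (nvar ''j'') (NConst 2)) (RCell to (nvar ''j'')) (RConst 1)) \<sigma>2 5 \<sigma>3"
    and s3: "same_vars \<sigma>2 \<sigma>3"
    and e3: "emitted I ((legs @ [(Travel, rcells \<sigma> from j)]) @ [(Reclaim j, rcells \<sigma> to j)]) \<sigma>3"
    by blast
  have "runs (emit_pile e from to) \<sigma> 11 \<sigma>3"
    using runs_Seq[OF r1 runs_Seq[OF r2 r3]] by (simp add: emit_pile_def del: One_nat_def)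
  moreover have "holds_input I \<sigma>3" "ncells \<sigma>3 ''k'' = ncells \<sigma> ''k''"
    using s2 s3 assms(2) by (auto simp: same_vars_def holds_input_def \<sigma>1_def set_cell_def)
  ultimately show ?thesis using e3 by auto
qed

definition loop_invar :: "reclaim_instance \<Rightarrow> nat \<Rightarrow> store \<Rightarrow> bool" where
  "loop_invar I k \<sigma> \<longleftrightarrow> holds_input I \<sigma> \<and> ncells \<sigma> ''k'' 0 = k \<and>
     emitted I (concat (map (pile_legs I) (take k (sweep_order I)))) \<sigma>"

text \<open>The 13 steps are 11 for the stockpile, one for the test and one for the
  increment.\<close>

lemma runs_sweep_body:
  assumes "loop_invar I k \<sigma>" "k < pile_count I" "pad1_count I \<le> pile_count I"
  shows "\<exists>\<tau>. runs sweep_body \<sigma> 13 \<tau> \<and> loop_invar I (k + 1) \<tau>"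
proof -
  let ?legs = "concat (map (pile_legs I) (take k (sweep_order I)))"
  let ?j = "sweep_order I ! k"
  let ?b = "NLess (nvar ''k'') (nvar ''n1'')"
  let ?p = "emit_pile (NPlus (nvar ''k'') (NConst 1)) ''l'' ''r''"
  let ?q = "emit_pile (NMinus (NPlus (nvar ''n'') (nvar ''n1'')) (nvar ''k'')) ''r'' ''l''"
  have inv: "holds_input I \<sigma>" "ncells \<sigma> ''k'' 0 = k" "emitted I ?legs \<sigma>"
    using assms(1) by (auto simp: loop_invar_def)
  have cells: "ncells \<sigma> ''n'' 0 = pile_count I" "ncells \<sigma> ''n1'' 0 = pad1_count I"
    using inv by (auto simp: holds_input_def)
  have j: "?j = (if k < pad1_count I then k + 1 else pile_count I + pad1_count I - k)"
    using sweep_order_nth[OF assms(2)] .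
  then have "?j \<in> {1..pile_count I}" using assms(2,3) by auto
  then have lr: "rcells \<sigma> ''l'' ?j = left_end I ?j" "rcells \<sigma> ''r'' ?j = right_end I ?j"
    using inv(1) unfolding holds_input_def by blast+
  have "\<exists>\<tau>. runs (Cond ?b ?p ?q) \<sigma> (11 + 1) \<tau> \<and> holds_input I \<tau> \<and>
    ncells \<tau> ''k'' = ncells \<sigma> ''k'' \<and> emitted I (?legs @ pile_legs I ?j) \<tau>"
  proof (cases "k < pad1_count I")
    case True
    then have "pile_legs I ?j = [(Travel, rcells \<sigma> ''l'' ?j), (Reclaim ?j, rcells \<sigma> ''r'' ?j)]"
      using j lr by (simp add: pile_legs_def)
    moreover have "?j = nval (NPlus (nvar ''k'') (NConst 1)) \<sigma>" "bval ?b \<sigma>"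
      using True j inv cells by auto
    ultimately show ?thesis
      using runs_emit_pile[OF inv(3,1), of ?j "NPlus (nvar ''k'') (NConst 1)" "''l''" "''r''"]
        runs_CondTrue[of ?b \<sigma> ?p 11 _ ?q] by auto
  next
    case False
    then have "\<not> ?j \<le> pad1_count I"
      using j assms(2) by auto
    then have "pile_legs I ?j = [(Travel, rcells \<sigma> ''r'' ?j), (Reclaim ?j, rcells \<sigma> ''l'' ?j)]"
      using lr by (simp add: pile_legs_def)
    moreover have "?j = nval (NMinus (NPlus (nvar ''n'') (nvar ''n1'')) (nvar ''k'')) \<sigma>"
      "\<not> bval ?b \<sigma>"
      using False j inv cells by auto
    ultimately show ?thesis
      using runs_emit_pile[OF inv(3,1), of ?j
          "NMinus (NPlus (nvar ''n'') (nvar ''n1'')) (nvar ''k'')" "''r''" "''l''"]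
        runs_CondFalse[of ?b \<sigma> ?q 11 _ ?p] by auto
  qed
  then obtain \<tau> where r: "runs (Cond ?b ?p ?q) \<sigma> (11 + 1) \<tau>" and \<tau>: "holds_input I \<tau>"
    "ncells \<tau> ''k'' = ncells \<sigma> ''k''" "emitted I (?legs @ pile_legs I ?j) \<tau>"
    by blast
  let ?\<tau> = "\<tau>\<lparr>ncells := set_cell (ncells \<tau>) ''k'' 0 (k + 1)\<rparr>"
  have "runs (NAssign ''k'' (NConst 0) (NPlus (nvar ''k'') (NConst 1))) \<tau> 1 ?\<tau>"
    using \<tau>(2) inv(2) by (intro runs_NAssignI) auto
  from runs_Seq[OF r this] have "runs sweep_body \<sigma> 13 ?\<tau>"
    by (simp add: sweep_body_def del: One_nat_def)
  moreover have "take (k + 1) (sweep_order I) = take k (sweep_order I) @ [?j]"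
    using assms(2) sweep_order_props(1)[OF assms(3)] by (simp add: take_Suc_conv_app_nth)
  then have "loop_invar I (k + 1) ?\<tau>"
    using \<tau> by (simp add: loop_invar_def holds_input_def emitted_def set_cell_def)
  ultimately show ?thesis by blast
qed

text \<open>Each round adds the loop test to the 13 steps of the body; the extra 1 is the final
  failing test. The induction runs downwards from \<open>pile_count I\<close>.\<close>

lemma runs_sweep_loop:
  assumes "loop_invar I k \<sigma>" "k \<le> pile_count I" "pad1_count I \<le> pile_count I"
  shows "\<exists>\<tau>. runs sweep_loop \<sigma> (14 * (pile_count I - k) + 1) \<tau> \<and> loop_invar I (pile_count I) \<tau>"
  using assms(2,1)
proof (induction k arbitrary: \<sigma> rule: inc_induct)
  case base
  then have "\<not> bval (NLess (nvar ''k'') (nvar ''n'')) \<sigma>"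
    by (simp add: loop_invar_def holds_input_def)
  then show ?case
    using base runs_WhileFalse unfolding sweep_loop_def by fastforce
next
  case (step k)
  then have b: "bval (NLess (nvar ''k'') (nvar ''n'')) \<sigma>"
    by (simp add: loop_invar_def holds_input_def)
  obtain \<sigma>' where body: "runs sweep_body \<sigma> 13 \<sigma>'" and \<sigma>': "loop_invar I (Suc k) \<sigma>'"
    using runs_sweep_body[OF step.prems step.hyps(2) assms(3)] by auto
  obtain \<tau> where loop: "runs sweep_loop \<sigma>' (14 * (pile_count I - Suc k) + 1) \<tau>"
    and \<tau>: "loop_invar I (pile_count I) \<tau>"
    using step.IH[OF \<sigma>'] by blast
  have cost: "14 * (pile_count I - k) + 1 = 13 + (14 * (pile_count I - Suc k) + 1) + 1"
    using step.hyps(2) by simp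
  have "runs sweep_loop \<sigma> (14 * (pile_count I - k) + 1) \<tau>"
    unfolding cost sweep_loop_def by (rule runs_WhileTrue[OF b body loop[unfolded sweep_loop_def]])
  with \<tau> show ?case by blast
qed

lemma runs_sweep_prog:
  assumes "valid_instance I"
  shows "\<exists>\<sigma>. runs sweep_prog (input_store I) (14 * pile_count I + 6) \<sigma> \<and> outputs \<sigma> (sweep I)"
proof -
  have s: "travel_speed I \<ge> 1" and le: "pad1_count I \<le> pile_count I"
    using assms by (auto simp: valid_instance_def)
  \<comment> \<open>Cells initialised to 0 already encode the empty list of legs: no pieces, time 0,
    position 0.\<close>
  have "loop_invar I 0 (input_store I)"
    by (auto simp: loop_invar_def holds_input_def emitted_def input_store_def)
  then obtain \<sigma> where r: "runs sweep_loop (input_store I) (14 * pile_count I + 1) \<sigma>"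
    and \<sigma>: "loop_invar I (pile_count I) \<sigma>"
    using runs_sweep_loop[of I 0 "input_store I"] le by auto
  let ?legs = "concat (map (pile_legs I) (sweep_order I))"
  have e: "emitted I ?legs \<sigma>" and h: "holds_input I \<sigma>"
    using \<sigma> sweep_order_props(1)[OF le] by (auto simp: loop_invar_def)
  obtain \<tau> where r': "runs (emit (NConst 1) (RConst 0) (RCell ''s'' (NConst 0))) \<sigma> 5 \<tau>"
    and \<tau>: "emitted I (sweep_legs I) \<tau>"
    using runs_emit[OF e, of "NConst 1" Travel "RConst 0" 0 "RCell ''s'' (NConst 0)"] h
    by (auto simp: sweep_legs_eq same_vars_def holds_input_def)
  have cost: "14 * pile_count I + 6 = 14 * pile_count I + 1 + 5"
    by simp
  have "runs sweep_prog (input_store I) (14 * pile_count I + 6) \<tau>"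
    unfolding cost sweep_prog_def by (rule runs_Seq[OF r r'])
  \<comment> \<open>Here the recorded ends of legs are identified with the values of the position
    function at the breakpoints.\<close>
  moreover have "outputs \<tau> (sweep I)"
    using \<tau> leg_position_breakpoint[OF valid_sweep_legs[OF assms] s, of _ 0
        "leg_position I 0 (sweep_legs I)"]
    by (simp add: outputs_def emitted_def sweep_def)
  ultimately show ?thesis by blast
qed

theorem theorem1:
  shows "\<exists>(prog :: com) (T :: nat \<Rightarrow> nat).
    (\<lambda>n. real (T n)) \<in> O(\<lambda>n. real n) \<and>
    (\<forall>I :: reclaim_instance. valid_instance I \<longrightarrow>
       optimal I (sweep I) \<and>
       (\<exists>c \<sigma>. runs prog (input_store I) c \<sigma> \<and> c \<le> T (pile_count I) \<and> outputs \<sigma> (sweep I)))"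
proof -
  \<comment> \<open>The factor 20 is 14 + 6, which suffices once \<open>n\<close> is at least
    1.\<close>
  have "eventually (\<lambda>n. norm (real (14 * n + 6)) \<le> 20 * norm (real n)) at_top"
    using eventually_ge_at_top[of 1] by eventually_elim auto
  then have "(\<lambda>n. real (14 * n + 6)) \<in> O(\<lambda>n. real n)"
    by (rule bigoI)
  then show ?thesis
    using sweep_optimal runs_sweep_prog
    by (intro exI[of _ sweep_prog] exI[of _ "\<lambda>n. 14 * n + 6"]) blast
qed

end
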